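(* Let $G$ be a graph and let $\alpha,\beta\in\mathbb{R}$ with $0<\alpha<\beta$. Then $$SDD_{\alpha}(G)\le SDD_{\beta}(G),$$ and equality holds if and only if each connected component of $G$ is a regular graph.
   Context: Graphs are finite, simple and undirected. For a graph $G$ with vertex set $V(G)$ and edge set $E(G)$, $d_u$ denotes the degree of the vertex $u$, and $uv$ denotes the edge joining $u$ and $v$. For $\alpha\in\mathbb{R}$, the variable symmetric division deg index is $$SDD_\alpha(G)=\sum_{uv\in E(G)}\left(\frac{d_u^\alpha}{d_v^\alpha}+\frac{d_v^\alpha}{d_u^\alpha}\right).$$ A graph is regular if all its vertices have the same degree. *)

theory Defs
  imports Complex_Main "Graph_Theory.Digraph_Component"
begin

(* A finite simple undirected graph is a structure satisfying the locale predicate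
   graph of Graph_Theory: finite, without loops and parallel arcs, and symmetric,
   so that an edge uv is represented by the two arcs (u,v) and (v,u). Degrees
   therefore count outgoing arcs only, and edges are unordered pairs, so that each
   edge contributes once to a sum over the edge set. *)

definition edges :: "('a, 'b) pre_digraph \<Rightarrow> 'a set set" where
  "edges G = {{u, v} | u v. u \<rightarrow>\<^bsub>G\<^esub> v}"

abbreviation degree :: "('a, 'b) pre_digraph \<Rightarrow> 'a \<Rightarrow> nat" where
  "degree G v \<equiv> out_degree G v"

(* The double sum ranges over the two orderings (u,v) and (v,u) of the ends of the
   edge e, see sdd_weight_edge. Ends of edges have positive degree, so the bases
   of the powers are positive and no division by zero occurs. *)
definition sdd_weight :: "('a, 'b) pre_digraph \<Rightarrow> real \<Rightarrow> 'a set \<Rightarrow> real" where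
  "sdd_weight G \<alpha> e =
     (\<Sum>u\<in>e. \<Sum>v\<in>e - {u}. real (degree G u) powr \<alpha> / real (degree G v) powr \<alpha>)"

lemma sdd_weight_edge:
  assumes "u \<noteq> v"
  shows "sdd_weight G \<alpha> {u, v} =
           real (degree G u) powr \<alpha> / real (degree G v) powr \<alpha> +
           real (degree G v) powr \<alpha> / real (degree G u) powr \<alpha>"
proof -
  have "{u, v} - {u} = {v}" "{u, v} - {v} = {u}"
    using assms by auto
  then show ?thesis
    using assms by (simp add: sdd_weight_def)
qed

definition SDD :: "real \<Rightarrow> ('a, 'b) pre_digraph \<Rightarrow> real" where
  "SDD \<alpha> G = (\<Sum>e\<in>edges G. sdd_weight G \<alpha> e)"

definition regular :: "('a, 'b) pre_digraph \<Rightarrow> bool" where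
  "regular G \<longleftrightarrow> (\<forall>u\<in>verts G. \<forall>v\<in>verts G. degree G u = degree G v)"

(* In a symmetric digraph reachability is symmetric, so the strongly connected
   components are the connected components of the undirected graph. *)
abbreviation connected_components :: "('a, 'b) pre_digraph \<Rightarrow> ('a, 'b) pre_digraph set" where
  "connected_components G \<equiv> pre_digraph.sccs G"

end

theory Submission
  imports Defs
begin

text \<open>
  For positive \<open>x\<close>, \<open>y\<close> the sum \<open>(x/y) powr \<alpha> + (y/x) powr \<alpha>\<close> is
  \<open>2 cosh (\<alpha> ln (x/y))\<close>, which is strictly increasing in \<open>\<alpha> > 0\<close> unless \<open>x = y\<close>, when it is
  constant. So \<open>SDD\<close> increases edge by edge, and equality holds iff the ends of each edge have equal
  degrees, i.e. iff the degree is constant along walks.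
\<close>

text \<open>Since \<open>cosh\<close> is even, the absolute value does not change the right-hand
  side; it keeps the argument nonnegative for \<open>\<alpha> > 0\<close>, where \<open>cosh\<close>
  is increasing.\<close>

lemma powr_divide_add_eq_cosh:
  fixes x y \<alpha> :: real
  assumes "0 < x" "0 < y"
  shows "x powr \<alpha> / y powr \<alpha> + y powr \<alpha> / x powr \<alpha> = 2 * cosh (\<alpha> * \<bar>ln x - ln y\<bar>)"
proof -
  have "x powr \<alpha> / y powr \<alpha> = exp (\<alpha> * (ln x - ln y))"
    "y powr \<alpha> / x powr \<alpha> = exp (- (\<alpha> * (ln x - ln y)))"
    using assms by (simp_all add: powr_def algebra_simps flip: exp_diff)
  then show ?thesis
    by (simp add: cosh_def abs_if algebra_simps)
qed

lemma powr_divide_add_mono: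
  fixes x y \<alpha> \<beta> :: real
  assumes "0 < x" "0 < y" "0 < \<alpha>" "\<alpha> < \<beta>"
  shows "x powr \<alpha> / y powr \<alpha> + y powr \<alpha> / x powr \<alpha> \<le> x powr \<beta> / y powr \<beta> + y powr \<beta> / x powr \<beta>"
  using assms by (simp add: powr_divide_add_eq_cosh cosh_real_nonneg_le_iff mult_right_mono)

text \<open>Equal values of \<open>cosh\<close> have arguments equal up to sign. With t =
  \<open>\<bar>ln x - ln y\<bar>\<close> this gives \<alpha> t = \<beta> t, so t = 0, and
  \<open>ln\<close> is injective on positive reals.\<close>

lemma powr_divide_add_eq_iff:
  fixes x y \<alpha> \<beta> :: real
  assumes "0 < x" "0 < y" "0 < \<alpha>" "\<alpha> < \<beta>"
  shows "x powr \<alpha> / y powr \<alpha> + y powr \<alpha> / x powr \<alpha> = x powr \<beta> / y powr \<beta> + y powr \<beta> / x powr \<beta>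
         \<longleftrightarrow> x = y"
  using assms by (simp add: powr_divide_add_eq_cosh abs_mult)

lemma (in fin_digraph) out_degree_pos:
  assumes "u \<rightarrow> v"
  shows "0 < out_degree G u"
proof -
  from assms obtain e where "e \<in> out_arcs G u" by auto
  then show ?thesis
    unfolding out_degree_def using finite_out_arcs[of u] by (auto simp: card_gt_0_iff)
qed

context graph
begin

text \<open>Symmetry supplies the reverse arc, so the head \<open>v\<close> also has positive
  out-degree. These are the side conditions of \<open>sdd_weight_edge\<close> and of the
  inequalities for powers.\<close>

lemma edgesE:
  assumes "e \<in> edges G"
  obtains u v where "e = {u, v}" "u \<rightarrow> v" "u \<noteq> v" "0 < degree G u" "0 < degree G v"
proof -
  from assms obtain u v where uv: "e = {u, v}" "u \<rightarrow> v"
    unfolding edges_def by blast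
  have "v \<rightarrow> u"
    using uv(2) sym_arcs by (auto simp: symmetric_def elim: symE)
  moreover have "u \<noteq> v"
    using uv(2) adj_not_same by auto
  ultimately show thesis
    using that uv out_degree_pos by blast
qed

lemma finite_edges: "finite (edges G)"
proof (rule finite_subset)
  show "edges G \<subseteq> Pow (verts G)"
    unfolding edges_def by (auto dest: adj_in_verts)
qed simp

lemma sdd_weight_mono:
  assumes "e \<in> edges G" "0 < \<alpha>" "\<alpha> < \<beta>"
  shows "sdd_weight G \<alpha> e \<le> sdd_weight G \<beta> e"
  using assms(1)
proof (cases rule: edgesE)
  case (1 u v)
  then show ?thesis
    using powr_divide_add_mono[of "degree G u" "degree G v"] assms(2,3)
    by (simp add: sdd_weight_edge)
qed

lemma sdd_weight_eq_iff:
  assumes "u \<rightarrow> v" "0 < \<alpha>" "\<alpha> < \<beta>"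
  shows "sdd_weight G \<alpha> {u, v} = sdd_weight G \<beta> {u, v} \<longleftrightarrow> degree G u = degree G v"
proof -
  have "{u, v} \<in> edges G"
    using assms(1) unfolding edges_def by blast
  \<comment> \<open>The ends obtained from \<open>edgesE\<close> agree with \<open>u\<close>,
    \<open>v\<close> only up to order, but the three facts are symmetric in them.\<close>
  then have "u \<noteq> v" "0 < degree G u" "0 < degree G v"
    by (auto elim!: edgesE simp: doubleton_eq_iff)
  then show ?thesis
    using powr_divide_add_eq_iff[of "degree G u" "degree G v"] assms(2,3)
    by (simp add: sdd_weight_edge)
qed

lemma SDD_mono:
  assumes "0 < \<alpha>" "\<alpha> < \<beta>"
  shows "SDD \<alpha> G \<le> SDD \<beta> G"
  unfolding SDD_def using assms by (intro sum_mono sdd_weight_mono)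

lemma SDD_eq_iff:
  assumes "0 < \<alpha>" "\<alpha> < \<beta>"
  shows "SDD \<alpha> G = SDD \<beta> G \<longleftrightarrow> (\<forall>u v. u \<rightarrow> v \<longrightarrow> degree G u = degree G v)"
proof -
  have "SDD \<alpha> G = SDD \<beta> G \<longleftrightarrow> (\<forall>e\<in>edges G. sdd_weight G \<alpha> e = sdd_weight G \<beta> e)"
    unfolding SDD_def
    \<comment> \<open>Finite sums with termwise inequality can only be equal if all their terms
      are.\<close>
    using sum_mono_inv[OF _ sdd_weight_mono[OF _ assms] _ finite_edges] by (auto intro: sum.cong)
  also have "\<dots> \<longleftrightarrow> (\<forall>u v. u \<rightarrow> v \<longrightarrow> sdd_weight G \<alpha> {u, v} = sdd_weight G \<beta> {u, v})"
    unfolding edges_def by blast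
  finally show ?thesis
    using sdd_weight_eq_iff assms by blast
qed

text \<open>By symmetry the ends of an arc reach each other, and the vertex set of a component is a
  full class of mutual reachability.\<close>

lemma component_closed:
  assumes "H \<in> sccs" "u \<in> verts H" "u \<rightarrow> v"
  shows "v \<in> verts H"
proof -
  have "verts H \<in> sccs_verts"
    using assms(1) by (intro in_sccs_vertsI_sccs imageI)
  moreover have "u \<rightarrow>\<^sup>* v" "v \<rightarrow>\<^sup>* u"
    using assms(3) symmetric_reachable' by auto
  ultimately show ?thesis
    using assms(2) unfolding in_sccs_verts_conv_reachable by blast
qed

text \<open>\<open>H\<close> is induced and no arc leaves it, so \<open>u\<close> keeps all its
  outgoing arcs. This lets \<open>regular H\<close>, which speaks of degrees in \<open>H\<close>, be
  read in terms of degrees in \<open>G\<close>.\<close>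

lemma degree_component:
  assumes "H \<in> sccs" "u \<in> verts H"
  shows "degree H u = degree G u"
proof -
  have H: "subgraph H G" "arcs H = {e \<in> arcs G. tail G e \<in> verts H \<and> head G e \<in> verts H}"
    using in_sccs_imp_induced[OF assms(1)] by auto
  have "tail H = tail G"
    using H(1) by (auto simp: subgraph_def compatible_def)
  moreover have "head G e \<in> verts H" if "e \<in> arcs G" "tail G e = u" for e
    using component_closed[OF assms] in_arcs_imp_in_arcs_ends that by blast
  ultimately have "out_arcs H u = out_arcs G u"
    using H(2) assms(2) by auto
  then show ?thesis
    by (simp add: out_degree_def)
qed

lemma components_regular_iff:
  "(\<forall>H\<in>sccs. regular H) \<longleftrightarrow> (\<forall>u v. u \<rightarrow> v \<longrightarrow> degree G u = degree G v)"
proof (intro iffI allI impI ballI)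
  fix u v
  assume reg: "\<forall>H\<in>sccs. regular H" and uv: "u \<rightarrow> v"
  \<comment> \<open>The component of \<open>u\<close>, which contains both ends of the arc.\<close>
  let ?H = "G \<restriction> {w. u \<rightarrow>\<^sup>* w}"
  have u: "u \<in> verts G"
    using uv by (rule adj_in_verts)
  then have H: "?H \<in> sccs"
    by (rule induce_reachable_is_in_sccs)
  have "u \<in> verts ?H" "v \<in> verts ?H"
    using u uv by auto
  then show "degree G u = degree G v"
    using reg H degree_component[OF H] unfolding regular_def by metis
next
  fix H
  assume adj: "\<forall>u v. u \<rightarrow> v \<longrightarrow> degree G u = degree G v" and H: "H \<in> sccs"
  have const: "degree G u = degree G v" if "u \<rightarrow>\<^sup>* v" for u v
    using that by (induction rule: reachable_induct) (use adj in auto)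
  \<comment> \<open>\<open>H\<close> is strongly connected, and a walk in \<open>H\<close> is also a
    walk in \<open>G\<close>, along which \<open>const\<close> applies.\<close>
  have "u \<rightarrow>\<^sup>* v" if "u \<in> verts H" "v \<in> verts H" for u v
  proof (rule reachable_mono)
    show "u \<rightarrow>\<^sup>*\<^bsub>H\<^esub> v" using H that by auto
    show "subgraph H G" using in_sccs_imp_induced[OF H] by auto
  qed
  then show "regular H"
    unfolding regular_def using const degree_component[OF H] by metis
qed

end

theorem theorem1:
  fixes G :: "('a, 'b) pre_digraph" and \<alpha> \<beta> :: real
  assumes "graph G" and "0 < \<alpha>" and "\<alpha> < \<beta>"
  shows "SDD \<alpha> G \<le> SDD \<beta> G \<and>
         (SDD \<alpha> G = SDD \<beta> G \<longleftrightarrow> (\<forall>H\<in>connected_components G. regular H))"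
proof -
  interpret graph G by fact
  show ?thesis
    using SDD_mono[OF assms(2,3)] SDD_eq_iff[OF assms(2,3)] components_regular_iff by blast
qed

end
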